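(* Let $f:X\to X$ be a continuous map on the compact Hausdorff space $X$, and let $\{\mathcal U_\lambda\}_{\lambda\in\Lambda}$ be a cofinal directed subset of $\mathcal{TOC}(X)$. Then for every $x\in X$ there is a choice of $U_\lambda(x)\in\mathcal U_\lambda$ ($\lambda\in\Lambda$) with $\{x\}=\bigcap_{\lambda\in\Lambda}\overline{U_\lambda(x)}$, and furthermore, for any such choice and for all $n\in\omega$, $$\{f^n(x)\}=\bigcap_{\lambda\in\Lambda}\ \bigcup\Big\{\overline V:\ V\in \pi_0\big(\sigma^n\big(\mathcal O(\mathcal U_\lambda)\cap\pi_0^{-1}(U_\lambda(x))\big)\big)\Big\}.$$
   Context: $\omega=\{0,1,2,\dots\}$. An open cover $\mathcal U$ of $X$ is taut if for $U,V\in\mathcal U$, $\overline U\cap\overline V\neq\varnothing$ only if $U\cap V\ne\varnothing$. $\mathcal{TOC}(X)$ is the collection of all finite taut open covers of $X$, partially ordered by refinement (finer covers are larger), which makes it a directed set; a cofinal directed subset $\{\mathcal U_\lambda\}_{\lambda\in\Lambda}$ is a directed family of such covers such that every member of $\mathcal{TOC}(X)$ is refined by some $\mathcal U_\lambda$. For a finite taut open cover $\mathcal U$, $\mathcal U^\omega$ is the space of sequences of elements of the finite alphabet $\mathcal U$, with shift map $\sigma\langle U_i\rangle=\langle U_{i+1}\rangle$ and coordinate projections $\pi_i:\mathcal U^\omega\to\mathcal U$. The $\mathcal U$-orbit space is $$\mathcal O(\mathcal U)=\{\langle U_i\rangle\in\mathcal U^\omega:\ \text{there is } z\in X \text{ with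 } f^i(z)\in\overline{U_i}\text{ for all } i\in\omega\}.$$ *)

theory Defs
  imports "HOL-Analysis.Analysis"
begin

definition open_cover :: "'a topology \<Rightarrow> 'a set set \<Rightarrow> bool" where
  "open_cover X \<U> \<longleftrightarrow> (\<forall>U\<in>\<U>. openin X U) \<and> \<Union>\<U> = topspace X"

definition taut :: "'a topology \<Rightarrow> 'a set set \<Rightarrow> bool" where
  "taut X \<U> \<longleftrightarrow>
     (\<forall>U\<in>\<U>. \<forall>V\<in>\<U>. X closure_of U \<inter> X closure_of V \<noteq> {} \<longrightarrow> U \<inter> V \<noteq> {})"

definition TOC :: "'a topology \<Rightarrow> 'a set set set" where
  "TOC X = {\<U>. finite \<U> \<and> open_cover X \<U> \<and> taut X \<U>}"

definition refines :: "'a set set \<Rightarrow> 'a set set \<Rightarrow> bool" where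
  "refines \<V> \<U> \<longleftrightarrow> (\<forall>V\<in>\<V>. \<exists>U\<in>\<U>. V \<subseteq> U)"

text \<open>
  The family is indexed by a set \<open>\<Lambda>\<close> of arbitrary type, and directedness is that of the family
  under refinement, with finer covers being larger. A subset of \<open>TOC X\<close> is the special case
  where the indexing map is the identity. Distinct indices may carry the same cover.
\<close>

definition directed_family :: "'l set \<Rightarrow> ('l \<Rightarrow> 'a set set) \<Rightarrow> bool" where
  "directed_family \<Lambda> \<U> \<longleftrightarrow>
     \<Lambda> \<noteq> {} \<and>
     (\<forall>a\<in>\<Lambda>. \<forall>b\<in>\<Lambda>. \<exists>c\<in>\<Lambda>. refines (\<U> c) (\<U> a) \<and> refines (\<U> c) (\<U> b))"

definition cofinal_directed_in_TOC :: "'a topology \<Rightarrow> 'l set \<Rightarrow> ('l \<Rightarrow> 'a set set) \<Rightarrow> bool" where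
  "cofinal_directed_in_TOC X \<Lambda> \<U> \<longleftrightarrow>
     \<U> ` \<Lambda> \<subseteq> TOC X \<and> directed_family \<Lambda> \<U> \<and>
     (\<forall>\<V>\<in>TOC X. \<exists>l\<in>\<Lambda>. refines (\<U> l) \<V>)"

definition seq_space :: "'b set \<Rightarrow> (nat \<Rightarrow> 'b) set" where
  "seq_space A = {s. \<forall>i. s i \<in> A}"

definition shift :: "(nat \<Rightarrow> 'b) \<Rightarrow> nat \<Rightarrow> 'b" where
  "shift s = (\<lambda>i. s (Suc i))"

definition proj :: "nat \<Rightarrow> (nat \<Rightarrow> 'b) \<Rightarrow> 'b" where
  "proj i s = s i"

definition orbit_space :: "'a topology \<Rightarrow> ('a \<Rightarrow> 'a) \<Rightarrow> 'a set set \<Rightarrow> (nat \<Rightarrow> 'a set) set" where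
  "orbit_space X f \<U> =
     {s \<in> seq_space \<U>. \<exists>z\<in>topspace X. \<forall>i. (f ^^ i) z \<in> X closure_of (s i)}"

end

theory Submission
  imports Defs
begin

text \<open>
  Every open cover consisting of two sets is taut: if the two sets are disjoint, they are clopen.
  Hence, given \<open>x\<close> in an open set \<open>W\<close>, regularity yields open sets
  \<open>x \<in> B \<subseteq> cl B \<subseteq> A \<subseteq> cl A \<subseteq> W\<close>, and \<open>{A, X - cl B}\<close> is a taut cover such that any
  member of a refinement having \<open>x\<close> in its closure lies in \<open>A\<close>, so that its closure lies in
  \<open>W\<close>. If \<open>y \<noteq> f\<^sup>n(x)\<close>, apply this at \<open>x\<close> with the preimage under \<open>f\<^sup>n\<close> of a neighbourhood of
  \<open>f\<^sup>n(x)\<close>, and at \<open>y\<close> with a neighbourhood of \<open>y\<close> disjoint from that one; a common refinement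
  from the directed family then keeps \<open>y\<close> out of the \<open>n\<close>-th set of every orbit starting at
  \<open>U\<^sub>\<lambda>(x)\<close>.
\<close>

lemma funpow_shift_apply: "(shift ^^ n) s i = s (i + n)"
  by (induction n arbitrary: i) (simp_all add: shift_def)

lemma continuous_map_funpow:
  assumes "continuous_map X X f"
  shows "continuous_map X X (f ^^ n)"
proof (induction n)
  case (Suc n)
  then show ?case
    unfolding funpow.simps(2) using assms by (rule continuous_map_compose)
qed simp

lemma regular_space_shrink:
  assumes "regular_space X" "openin X W" "x \<in> W"
  obtains A where "openin X A" "x \<in> A" "X closure_of A \<subseteq> W"
proof -
  have "neighbourhood_base_of (closedin X) X"
    using assms(1) neighbourhood_base_of_closedin by blast
  then obtain A C where "openin X A" "closedin X C" "x \<in> A" "A \<subseteq> C" "C \<subseteq> W"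
    using assms(2,3) unfolding neighbourhood_base_of by metis
  then show thesis
    using that closure_of_minimal by (metis subset_trans)
qed

lemma TOC_two_sets:
  assumes "openin X U" "openin X V" "U \<union> V = topspace X"
  shows "{U, V} \<in> TOC X"
proof -
  have "X closure_of U \<inter> X closure_of V = {}" if "U \<inter> V = {}"
  proof -
    have "U = topspace X - V" "V = topspace X - U"
      using assms(3) that by blast+
    then have "closedin X U" "closedin X V"
      using assms(1,2) by (metis closedin_diff closedin_topspace)+
    then show ?thesis
      using that by (simp add: closure_of_closedin)
  qed
  \<comment> \<open>A pair of equal members causes no trouble: a set with nonempty closure is itself
    nonempty.\<close>
  then show ?thesis
    using assms unfolding TOC_def open_cover_def taut_def by (auto simp: Int_commute)
qed

text \<open>Quantifying over all refinements \<open>\<U>\<close> of \<open>\<V>\<close> lets the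
  property pass to a common refinement of two such covers.\<close>

lemma taut_cover_at_point:
  assumes "regular_space X" "openin X W" "x \<in> W"
  obtains \<V> where "\<V> \<in> TOC X"
    "\<And>\<U> U. refines \<U> \<V> \<Longrightarrow> U \<in> \<U> \<Longrightarrow> x \<in> X closure_of U \<Longrightarrow> X closure_of U \<subseteq> W"
proof -
  obtain A where A: "openin X A" "x \<in> A" "X closure_of A \<subseteq> W"
    using regular_space_shrink[OF assms] .
  obtain B where B: "openin X B" "x \<in> B" "X closure_of B \<subseteq> A"
    using regular_space_shrink[OF assms(1) A(1,2)] .
  define V where "V = topspace X - X closure_of B"
  have "{A, V} \<in> TOC X"
  proof (rule TOC_two_sets)
    show "A \<union> V = topspace X"
      using B(3) openin_subset[OF A(1)] by (auto simp: V_def)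
  qed (use A V_def in auto)
  moreover have "X closure_of U \<subseteq> W"
    if "refines \<U> {A, V}" "U \<in> \<U>" "x \<in> X closure_of U" for \<U> U
  proof -
    \<comment> \<open>The neighbourhood \<open>B\<close> of \<open>x\<close> meets \<open>U\<close>,
      while \<open>V\<close> misses even the closure of \<open>B\<close>.\<close>
    have "\<not> U \<subseteq> V"
      using that(3) B(1,2) closure_of_subset[OF openin_subset[OF B(1)]]
      unfolding in_closure_of V_def by blast
    then have "U \<subseteq> A"
      using that(1,2) unfolding refines_def by blast
    then show ?thesis
      using A(3) closure_of_mono by blast
  qed
  ultimately show thesis
    using that by blast
qed

lemma refines_trans:
  assumes "refines \<W> \<V>" "refines \<V> \<U>"
  shows "refines \<W> \<U>"
  using assms unfolding refines_def by (meson subset_trans)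

lemma cofinal_directed_at_point:
  assumes "regular_space X" "cofinal_directed_in_TOC X \<Lambda> \<U>" "openin X W" "x \<in> W"
  obtains l where "l \<in> \<Lambda>"
    "\<And>\<V> U. refines \<V> (\<U> l) \<Longrightarrow> U \<in> \<V> \<Longrightarrow> x \<in> X closure_of U \<Longrightarrow> X closure_of U \<subseteq> W"
proof -
  obtain \<W> where \<W>: "\<W> \<in> TOC X"
    "\<And>\<V> U. refines \<V> \<W> \<Longrightarrow> U \<in> \<V> \<Longrightarrow> x \<in> X closure_of U \<Longrightarrow> X closure_of U \<subseteq> W"
    using taut_cover_at_point[OF assms(1,3,4)] by metis
  obtain l where "l \<in> \<Lambda>" "refines (\<U> l) \<W>"
    using assms(2) \<W>(1) unfolding cofinal_directed_in_TOC_def by blast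
  then show thesis
    using that \<W>(2) refines_trans by meson
qed

lemma cofinal_directed_cover:
  assumes "cofinal_directed_in_TOC X \<Lambda> \<U>" "l \<in> \<Lambda>" "x \<in> topspace X"
  shows "\<exists>U\<in>\<U> l. x \<in> X closure_of U"
proof -
  have *: "open_cover X (\<U> l)"
    using assms(1,2) unfolding cofinal_directed_in_TOC_def TOC_def by blast
  then obtain U where "U \<in> \<U> l" "x \<in> U"
    using assms(3) unfolding open_cover_def by blast
  then show ?thesis
    using * closure_of_subset openin_subset unfolding open_cover_def by (metis subsetD)
qed

lemma Inter_closures_eq_singleton:
  assumes "compact_space X" "Hausdorff_space X" "cofinal_directed_in_TOC X \<Lambda> \<U>"
    and x: "x \<in> topspace X"
    and Ux: "\<And>l. l \<in> \<Lambda> \<Longrightarrow> Ux l \<in> \<U> l" "\<And>l. l \<in> \<Lambda> \<Longrightarrow> x \<in> X closure_of (Ux l)"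
  shows "(\<Inter>l\<in>\<Lambda>. X closure_of (Ux l)) = {x}"
proof -
  have reg: "regular_space X"
    using assms(1,2) compact_Hausdorff_imp_regular_space by blast
  have "\<exists>l\<in>\<Lambda>. y \<notin> X closure_of (Ux l)" if "y \<noteq> x" for y
  proof -
    \<comment> \<open>Deleting a point leaves an open set by T1, also when \<open>y\<close> is
      outside the space. This set serves as the neighbourhood of \<open>x\<close>.\<close>
    have "openin X (topspace X - {y})"
      using assms(2) Hausdorff_imp_t1_space t1_space_openin_delete_alt by blast
    moreover have "x \<in> topspace X - {y}"
      using x that by blast
    ultimately obtain l where l: "l \<in> \<Lambda>"
      "\<And>\<V> U. refines \<V> (\<U> l) \<Longrightarrow> U \<in> \<V> \<Longrightarrow> x \<in> X closure_of U
          \<Longrightarrow> X closure_of U \<subseteq> topspace X - {y}"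
      using cofinal_directed_at_point[OF reg assms(3)] by metis
    have "refines (\<U> l) (\<U> l)"
      unfolding refines_def by blast
    then have "X closure_of (Ux l) \<subseteq> topspace X - {y}"
      using l Ux by blast
    then show ?thesis
      using l(1) by blast
  qed
  then show ?thesis
    using Ux(2) by blast
qed

text \<open>Shifting \<open>n\<close> times and reading entry 0 amounts to reading entry
  \<open>n\<close>; this removes shifts and projections from the later arguments.\<close>

lemma coordinate_of_orbit_space:
  "V \<in> proj 0 ` ((shift ^^ n) ` (orbit_space X f \<C> \<inter> proj 0 -` {U})) \<longleftrightarrow>
    (\<exists>s\<in>orbit_space X f \<C>. s 0 = U \<and> s n = V)"
  by (auto simp: proj_def funpow_shift_apply image_iff)

text \<open>An itinerary of \<open>x\<close> itself is a witness once its entry 0 is replaced by the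
  prescribed \<open>U\<close>. The result is still an orbit sequence because \<open>x\<close> lies
  in the closure of \<open>U\<close>.\<close>

lemma funpow_in_coordinate_closure:
  assumes "continuous_map X X f" "cofinal_directed_in_TOC X \<Lambda> \<U>" "l \<in> \<Lambda>"
    and x: "x \<in> topspace X" and U: "U \<in> \<U> l" "x \<in> X closure_of U"
  shows "\<exists>s\<in>orbit_space X f (\<U> l). s 0 = U \<and> (f ^^ n) x \<in> X closure_of (s n)"
proof -
  have "(f ^^ i) x \<in> topspace X" for i
    using continuous_map_funpow[OF assms(1)] x by (metis continuous_map_def PiE)
  then have "\<exists>V\<in>\<U> l. (f ^^ i) x \<in> X closure_of V" for i
    using cofinal_directed_cover[OF assms(2,3)] by blast
  then obtain t where t: "\<And>i. t i \<in> \<U> l" "\<And>i. (f ^^ i) x \<in> X closure_of (t i)"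
    by metis
  have s: "(t(0 := U)) i \<in> \<U> l" "(f ^^ i) x \<in> X closure_of ((t(0 := U)) i)" for i
    using t U by (cases i; simp del: funpow.simps(2))+
  then have "t(0 := U) \<in> orbit_space X f (\<U> l)"
    using x unfolding orbit_space_def seq_space_def by blast
  then show ?thesis
    using s(2)[of n] by (intro bexI[of _ "t(0 := U)"]) auto
qed

lemma separating_index:
  assumes "compact_space X" "Hausdorff_space X" "continuous_map X X f"
    and cof: "cofinal_directed_in_TOC X \<Lambda> \<U>"
    and x: "x \<in> topspace X" and y: "y \<in> topspace X" "y \<noteq> (f ^^ n) x"
  obtains l where "l \<in> \<Lambda>"
    "\<And>s. s \<in> orbit_space X f (\<U> l) \<Longrightarrow> x \<in> X closure_of (s 0) \<Longrightarrow> y \<notin> X closure_of (s n)"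
proof -
  have reg: "regular_space X"
    using assms(1,2) compact_Hausdorff_imp_regular_space by blast
  have cont: "continuous_map X X (f ^^ n)"
    using continuous_map_funpow[OF assms(3)] .
  then have "(f ^^ n) x \<in> topspace X"
    using x by (metis continuous_map_def PiE)
  then obtain W N where WN: "openin X W" "openin X N" "(f ^^ n) x \<in> W" "y \<in> N" "disjnt W N"
    using assms(2) y unfolding Hausdorff_space_def by metis
  \<comment> \<open>Control at time \<open>n\<close> is pulled back to time 0: every orbit that
    starts in \<open>P\<close> is in \<open>W\<close> after \<open>n\<close> steps.\<close>
  define P where "P = {p \<in> topspace X. (f ^^ n) p \<in> W}"
  have "openin X P"
    unfolding P_def using cont WN(1) by (rule openin_continuous_map_preimage)
  moreover have "x \<in> P"
    using x WN(3) by (simp add: P_def)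
  ultimately obtain a where a: "a \<in> \<Lambda>"
    "\<And>\<V> U. refines \<V> (\<U> a) \<Longrightarrow> U \<in> \<V> \<Longrightarrow> x \<in> X closure_of U \<Longrightarrow> X closure_of U \<subseteq> P"
    using cofinal_directed_at_point[OF reg cof] by metis
  obtain b where b: "b \<in> \<Lambda>"
    "\<And>\<V> U. refines \<V> (\<U> b) \<Longrightarrow> U \<in> \<V> \<Longrightarrow> y \<in> X closure_of U \<Longrightarrow> X closure_of U \<subseteq> N"
    using cofinal_directed_at_point[OF reg cof WN(2,4)] by metis
  obtain c where c: "c \<in> \<Lambda>" "refines (\<U> c) (\<U> a)" "refines (\<U> c) (\<U> b)"
    using cof a(1) b(1) unfolding cofinal_directed_in_TOC_def directed_family_def by blast
  show thesis
  proof (rule that[OF c(1)])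
    fix s
    assume s: "s \<in> orbit_space X f (\<U> c)" "x \<in> X closure_of (s 0)"
    show "y \<notin> X closure_of (s n)"
    proof
      assume "y \<in> X closure_of (s n)"
      \<comment> \<open>The point \<open>z\<close> realizing \<open>s\<close> need not be
        \<open>x\<close>. Entry 0 still forces \<open>z\<close> into \<open>P\<close>, so its
        \<open>n\<close>-th iterate is in \<open>W\<close>, and entry \<open>n\<close> forces that
        iterate into the disjoint set \<open>N\<close>.\<close>
      obtain z where z: "\<And>i. (f ^^ i) z \<in> X closure_of (s i)" and mem: "\<And>i. s i \<in> \<U> c"
        using s(1) unfolding orbit_space_def seq_space_def by blast
      have "z \<in> P"
        using a(2)[OF c(2) mem s(2)] z[of 0] by auto
      moreover have "(f ^^ n) z \<in> N"
        using b(2)[OF c(3) mem \<open>y \<in> X closure_of (s n)\<close>] z[of n] by blast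
      ultimately show False
        using WN(5) unfolding P_def disjnt_def by blast
    qed
  qed
qed

theorem theorem11:
  fixes X :: "'a topology" and f :: "'a \<Rightarrow> 'a"
    and \<Lambda> :: "'l set" and \<U> :: "'l \<Rightarrow> 'a set set"
  assumes "compact_space X" and "Hausdorff_space X"
    and "continuous_map X X f"
    and "cofinal_directed_in_TOC X \<Lambda> \<U>"
  shows "\<forall>x\<in>topspace X.
    (\<exists>Ux. (\<forall>l\<in>\<Lambda>. Ux l \<in> \<U> l) \<and> {x} = (\<Inter>l\<in>\<Lambda>. X closure_of (Ux l))) \<and>
    (\<forall>Ux. (\<forall>l\<in>\<Lambda>. Ux l \<in> \<U> l) \<and> {x} = (\<Inter>l\<in>\<Lambda>. X closure_of (Ux l)) \<longrightarrow>
      (\<forall>n. {(f ^^ n) x} =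
        (\<Inter>l\<in>\<Lambda>. \<Union>{X closure_of V | V.
           V \<in> proj 0 ` ((shift ^^ n) ` (orbit_space X f (\<U> l) \<inter> proj 0 -` {Ux l}))})))"
proof (intro ballI conjI allI impI)
  fix x
  assume x: "x \<in> topspace X"
  obtain Ux where "\<And>l. l \<in> \<Lambda> \<Longrightarrow> Ux l \<in> \<U> l \<and> x \<in> X closure_of (Ux l)"
    using cofinal_directed_cover[OF assms(4) _ x] by metis
  then show "\<exists>Ux. (\<forall>l\<in>\<Lambda>. Ux l \<in> \<U> l) \<and> {x} = (\<Inter>l\<in>\<Lambda>. X closure_of (Ux l))"
    using Inter_closures_eq_singleton[OF assms(1,2,4) x] by metis
next
  fix x Ux n
  assume x: "x \<in> topspace X"
    and "(\<forall>l\<in>\<Lambda>. Ux l \<in> \<U> l) \<and> {x} = (\<Inter>l\<in>\<Lambda>. X closure_of (Ux l))"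
  then have Ux: "\<And>l. l \<in> \<Lambda> \<Longrightarrow> Ux l \<in> \<U> l" "\<And>l. l \<in> \<Lambda> \<Longrightarrow> x \<in> X closure_of (Ux l)"
    by blast+
  define S where "S l = (\<Union>{X closure_of V | V.
    V \<in> proj 0 ` ((shift ^^ n) ` (orbit_space X f (\<U> l) \<inter> proj 0 -` {Ux l}))})" for l
  have S: "y \<in> S l \<longleftrightarrow> (\<exists>s\<in>orbit_space X f (\<U> l). s 0 = Ux l \<and> y \<in> X closure_of (s n))" for y l
    unfolding S_def coordinate_of_orbit_space by blast
  have "{(f ^^ n) x} = (\<Inter>l\<in>\<Lambda>. S l)"
  proof (intro equalityI subsetI)
    fix y
    assume "y \<in> {(f ^^ n) x}"
    then show "y \<in> (\<Inter>l\<in>\<Lambda>. S l)"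
      using funpow_in_coordinate_closure[OF assms(3,4) _ x] Ux by (auto simp: S)
  next
    fix y
    assume y: "y \<in> (\<Inter>l\<in>\<Lambda>. S l)"
    \<comment> \<open>A directed family has a nonempty index set. Over the empty set the
      intersection would be the whole type, and \<open>y\<close> could lie outside the
      space.\<close>
    obtain l where "l \<in> \<Lambda>"
      using assms(4) unfolding cofinal_directed_in_TOC_def directed_family_def by blast
    then obtain s where "y \<in> X closure_of (s n)"
      using y S by (metis INT_E)
    then have "y \<in> topspace X"
      by (simp add: in_closure_of)
    show "y \<in> {(f ^^ n) x}"
    proof (rule ccontr)
      assume "y \<notin> {(f ^^ n) x}"
      then obtain l where l: "l \<in> \<Lambda>" "\<And>s. s \<in> orbit_space X f (\<U> l) \<Longrightarrow>
          x \<in> X closure_of (s 0) \<Longrightarrow> y \<notin> X closure_of (s n)"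
        using separating_index[OF assms x \<open>y \<in> topspace X\<close>] by blast
      \<comment> \<open>At this index, membership of \<open>y\<close> in \<open>S l\<close> supplies
        an orbit sequence with entry 0 equal to \<open>Ux l\<close>, whose closure contains
        \<open>x\<close>, and with \<open>y\<close> in the closure of entry
        \<open>n\<close>.\<close>
      then show False
        using y S Ux(2) by (metis INT_E)
    qed
  qed
  then show "{(f ^^ n) x} = (\<Inter>l\<in>\<Lambda>. \<Union>{X closure_of V | V.
      V \<in> proj 0 ` ((shift ^^ n) ` (orbit_space X f (\<U> l) \<inter> proj 0 -` {Ux l}))})"
    unfolding S_def .
qed

end
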